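(* Let $M$ be a (nonempty) closed manifold of dimension $a\ge1$ and let $N$ be either $\mathbb{R}$ or the circle $\mathbb{S}^1$. Then $P^\infty(M,N)=\emptyset$; that is, there is no cross-free map $h:M\times N\to\mathbb{R}^{a}$.
   Context: Let $M$ be an $a$-dimensional manifold with (local) coordinates $(x^i)$ and $N$ a $b$-dimensional manifold with (local) coordinates $(y^\alpha)$. A $C^\infty$ map $h:M\times N\to\mathbb{R}^{ab}$ is cross-free if, for every $(x,y)\in M\times N$, its mixed Hessian, i.e. the linear map $H_h(x,y):T_xM\otimes T_yN\to\mathbb{R}^{ab}$, $\frac{\partial}{\partial x^i}\otimes\frac{\partial}{\partial y^\alpha}\mapsto\frac{\partial^2 h}{\partial x^i\partial y^\alpha}(x,y)$, is invertible (this condition is independent of the choice of coordinates). $P^\infty(M,N)\subset C^\infty(M\times N,\mathbb{R}^{ab})$ denotes the set of all cross-free maps on $M\times N$. A closed manifold is a compact manifold without boundary. *)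

theory Defs
  imports "HOL-Analysis.Analysis"
begin

section \<open>Smooth functions on open subsets of Euclidean spaces\<close>

text \<open>Only meant for open \<open>S\<close>: derivatives are taken in the ambient space.\<close>

fun Ck_on :: "nat \<Rightarrow> 'e::euclidean_space set \<Rightarrow> ('e \<Rightarrow> 'f::real_normed_vector) \<Rightarrow> bool" where
  "Ck_on 0 S f \<longleftrightarrow> continuous_on S f"
| "Ck_on (Suc k) S f \<longleftrightarrow>
     (\<forall>x\<in>S. f differentiable (at x)) \<and> (\<forall>v. Ck_on k S (\<lambda>x. frechet_derivative f (at x) v))"

definition smooth_on :: "'e::euclidean_space set \<Rightarrow> ('e \<Rightarrow> 'f::real_normed_vector) \<Rightarrow> bool" where
  "smooth_on S f \<longleftrightarrow> (\<forall>k. Ck_on k S f)"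


section \<open>Smooth manifolds\<close>

text \<open>
  A manifold is a topology on a set of points together with an atlas of charts \<open>(U, \<phi>)\<close>, each of
  them a homeomorphism from an open set \<open>U\<close> onto an open subset of the model space \<open>'e\<close>, so that
  there is no boundary and the dimension is \<open>DIM('e)\<close>. The atlas need not be maximal. Chart maps
  are total functions whose values outside \<open>U\<close> are irrelevant.
\<close>

record ('p, 'e) manifold =
  mtop :: "'p topology"
  atlas :: "('p set \<times> ('p \<Rightarrow> 'e)) set"

definition smooth_manifold :: "('p, 'e::euclidean_space) manifold \<Rightarrow> bool" where
  "smooth_manifold M \<longleftrightarrow>
     Hausdorff_space (mtop M) \<and> second_countable (mtop M) \<and>
     \<Union> (fst ` atlas M) = topspace (mtop M) \<and>
     (\<forall>(U, \<phi>) \<in> atlas M.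
        openin (mtop M) U \<and> open (\<phi> ` U) \<and>
        homeomorphic_map (subtopology (mtop M) U) (top_of_set (\<phi> ` U)) \<phi>) \<and>
     (\<forall>(U, \<phi>) \<in> atlas M. \<forall>(V, \<psi>) \<in> atlas M.
        smooth_on (\<phi> ` (U \<inter> V)) (\<psi> \<circ> inv_into U \<phi>))"

definition closed_manifold :: "('p, 'e::euclidean_space) manifold \<Rightarrow> bool" where
  "closed_manifold M \<longleftrightarrow> smooth_manifold M \<and> compact_space (mtop M)"

definition prod_manifold ::
    "('p, 'e::euclidean_space) manifold \<Rightarrow> ('q, 'f::euclidean_space) manifold \<Rightarrow>
     ('p \<times> 'q, 'e \<times> 'f) manifold" where
  "prod_manifold M N =
     \<lparr>mtop = prod_topology (mtop M) (mtop N),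
      atlas = {(U \<times> V, map_prod \<phi> \<psi>) | U \<phi> V \<psi>. (U, \<phi>) \<in> atlas M \<and> (V, \<psi>) \<in> atlas N}\<rparr>"

definition smooth_map ::
    "('p, 'e::euclidean_space) manifold \<Rightarrow> ('p \<Rightarrow> 'f::real_normed_vector) \<Rightarrow> bool" where
  "smooth_map M f \<longleftrightarrow> (\<forall>(U, \<phi>) \<in> atlas M. smooth_on (\<phi> ` U) (f \<circ> inv_into U \<phi>))"

definition real_line :: "(real, real ^ 1) manifold" where
  "real_line = \<lparr>mtop = euclidean, atlas = {(UNIV, vec)}\<rparr>"

text \<open>The unit circle in the complex plane with two angular coordinates, with values in
  \<open>(-\<pi>, \<pi>)\<close> and \<open>(0, 2\<pi>)\<close> respectively.\<close>

definition circle :: "(complex, real ^ 1) manifold" where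
  "circle =
     \<lparr>mtop = top_of_set (sphere 0 1),
      atlas = {(sphere 0 1 - {-1}, \<lambda>z. vec (Arg z)), (sphere 0 1 - {1}, \<lambda>z. vec (Arg2pi z))}\<rparr>"


section \<open>Cross-free maps\<close>

text \<open>
  The tensor product \<open>\<real>\<^sup>m \<otimes> \<real>\<^sup>n\<close> is rendered as \<^typ>\<open>real ^ ('m \<times> 'n)\<close>, the coordinate \<open>(i, \<alpha>)\<close>
  being that of \<open>\<partial>/\<partial>x\<^sup>i \<otimes> \<partial>/\<partial>y\<^sup>\<alpha>\<close>.
\<close>

definition mixed_partial ::
    "((real ^ 'm) \<times> (real ^ 'n) \<Rightarrow> real ^ 'k) \<Rightarrow> real ^ 'm \<Rightarrow> real ^ 'n \<Rightarrow> 'm \<Rightarrow> 'n \<Rightarrow> real ^ 'k" where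
  "mixed_partial g u v i \<alpha> =
     frechet_derivative
       (\<lambda>u'. frechet_derivative (\<lambda>v'. g (u', v')) (at v) (axis \<alpha> 1)) (at u) (axis i 1)"

definition mixed_hessian ::
    "((real ^ 'm) \<times> (real ^ 'n) \<Rightarrow> real ^ 'k) \<Rightarrow> real ^ 'm \<Rightarrow> real ^ 'n \<Rightarrow>
     real ^ ('m \<times> 'n) \<Rightarrow> real ^ 'k" where
  "mixed_hessian g u v t =
     (\<Sum>i\<in>UNIV. \<Sum>\<alpha>\<in>UNIV. (t $ (i, \<alpha>)) *\<^sub>R mixed_partial g u v i \<alpha>)"

text \<open>
  The target \<open>\<real>\<^sup>a\<^sup>b\<close> is \<^typ>\<open>real ^ 'k\<close> for an index type with \<open>CARD('k) = CARD('m) * CARD('n)\<close>. The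
  maps are total functions on the point types; only their values on \<open>M \<times> N\<close> matter.
\<close>

definition cross_free ::
    "('p, real ^ 'm) manifold \<Rightarrow> ('q, real ^ 'n) manifold \<Rightarrow> ('p \<times> 'q \<Rightarrow> real ^ 'k) \<Rightarrow> bool" where
  "cross_free M N h \<longleftrightarrow>
     smooth_map (prod_manifold M N) h \<and>
     (\<forall>(U, \<phi>) \<in> atlas M. \<forall>(V, \<psi>) \<in> atlas N. \<forall>x\<in>U. \<forall>y\<in>V.
        bij (mixed_hessian (h \<circ> inv_into (U \<times> V) (map_prod \<phi> \<psi>)) (\<phi> x) (\<psi> y)))"

definition P_infinity ::
    "('p, real ^ 'm) manifold \<Rightarrow> ('q, real ^ 'n) manifold \<Rightarrow> ('p \<times> 'q \<Rightarrow> real ^ 'k) set" where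
  "P_infinity M N = {h. cross_free M N h}"


section \<open>The line and the circle are manifolds\<close>

lemma Ck_on_const: "Ck_on k S (\<lambda>x. c)"
  by (induction k arbitrary: c) simp_all

lemma smooth_on_locally_translation:
  fixes f :: "'e::euclidean_space \<Rightarrow> 'e"
  assumes "open S" and loc: "\<And>x. x \<in> S \<Longrightarrow> \<exists>T c. open T \<and> x \<in> T \<and> (\<forall>y\<in>T. f y = y + c)"
  shows "smooth_on S f"
proof -
  have der: "(f has_derivative (\<lambda>h. h)) (at x)" if "x \<in> S" for x
  proof -
    obtain T c where T: "open T" "x \<in> T" "\<And>y. y \<in> T \<Longrightarrow> f y = y + c" using loc[OF \<open>x \<in> S\<close>] by blast
    have "((\<lambda>y. y + c) has_derivative (\<lambda>h. h)) (at x)"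
      by (auto intro!: derivative_eq_intros)
    then show ?thesis
      by (rule has_derivative_transform_within_open[OF _ T(1,2)]) (use T in auto)
  qed
  have fd: "frechet_derivative f (at x) = (\<lambda>h. h)" if "x \<in> S" for x
    using frechet_derivative_at[OF der[OF that]] by simp
  have cong: "Ck_on k S g" if "\<forall>x\<in>S. g x = v" for k v and g :: "'e \<Rightarrow> 'e"
    using that
  proof (induction k arbitrary: g v)
    case 0
    then show ?case by (simp cong: continuous_on_cong)
  next
    case (Suc k)
    have d: "(g has_derivative (\<lambda>h. 0)) (at x)" if "x \<in> S" for x
      by (rule has_derivative_transform_within_open[OF has_derivative_const \<open>open S\<close> that])
         (use Suc.prems in auto)
    then have "frechet_derivative g (at x) w = 0" if "x \<in> S" for x w
      using frechet_derivative_at[OF d[OF that]] by (metis (mono_tags))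
    then have "Ck_on k S (\<lambda>x. frechet_derivative g (at x) w)" for w
      by (intro Suc.IH[of _ 0]) auto
    moreover have "g differentiable (at x)" if "x \<in> S" for x
      using d[OF that] by (rule differentiableI)
    ultimately show ?case by simp
  qed
  have "Ck_on k S f" for k
  proof (cases k)
    case 0
    then show ?thesis using der
      by (auto intro!: continuous_at_imp_continuous_on has_derivative_continuous)
  next
    case (Suc n)
    have "Ck_on n S (\<lambda>x. frechet_derivative f (at x) v)" for v
      by (rule cong[of _ v]) (simp add: fd)
    then show ?thesis using Suc der by (auto simp: differentiable_def)
  qed
  then show ?thesis by (simp add: smooth_on_def)
qed

lemma second_countable_top_of_set:
  "second_countable (top_of_set (S :: 'a::second_countable_topology set))"
proof -
  obtain B :: "'a set set" where B: "countable B" "\<And>V. V \<in> B \<Longrightarrow> open V"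
    "\<And>S. open S \<Longrightarrow> \<exists>U. U \<subseteq> B \<and> S = \<Union>U"
    by (metis univ_second_countable)
  have "second_countable (euclidean :: 'a topology)"
    unfolding second_countable_def
    by (rule exI[of _ B]) (use B in \<open>fastforce\<close>)
  then show ?thesis by (simp add: second_countable_subtopology)
qed

lemma homeomorphism_imp_homeomorphic_map:
  "homeomorphism S T f g \<Longrightarrow> homeomorphic_map (top_of_set S) (top_of_set T) f"
  by (auto simp: homeomorphic_map_maps homeomorphic_maps_def homeomorphism_def intro!: exI[of _ g])

lemma vec_nth_1: "vec (x $ 1) = (x :: real ^ 1)"
  by (simp add: vec_eq_iff)

lemma homeomorphism_vec: "homeomorphism UNIV UNIV (vec :: real \<Rightarrow> real^1) (\<lambda>x. x $ 1)"
proof -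
  have "continuous_on UNIV (vec :: real \<Rightarrow> real^1)"
    unfolding vec_def by (intro continuous_intros)
  then show ?thesis
    by (auto simp: homeomorphism_def vec_nth_1 image_iff intro!: continuous_intros exI[of _ "vec _"])
      (metis vec_nth_1)
qed

lemma smooth_manifold_real_line: "smooth_manifold real_line"
proof -
  have img: "range vec = (UNIV :: (real^1) set)"
    using homeomorphism_vec by (simp add: homeomorphism_def)
  have "smooth_on UNIV (vec \<circ> inv_into UNIV vec :: real^1 \<Rightarrow> real^1)"
    by (rule smooth_on_locally_translation)
       (use img in \<open>auto simp: f_inv_into_f intro: exI[of _ UNIV]\<close>)
  then show ?thesis
    using homeomorphism_imp_homeomorphic_map[OF homeomorphism_vec]
      second_countable_top_of_set[of "UNIV :: real set"]
    by (simp add: smooth_manifold_def real_line_def img)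
qed

lemma homeomorphism_Arg:
  "homeomorphism (sphere 0 1 - {-1}) {v. -pi < v $ 1 \<and> v $ 1 < pi}
     (\<lambda>z. vec (Arg z) :: real^1) (\<lambda>v. cis (v $ 1))"
proof -
  have *: "z \<notin> \<real>\<^sub>\<le>\<^sub>0" if "norm z = 1" "z \<noteq> -1" for z :: complex
    using that by (auto elim!: nonpos_Reals_cases)
  have bd: "-pi < Arg z \<and> Arg z < pi" if "norm z = 1" "z \<noteq> -1" for z :: complex
    using Arg_bounded[of z] *[OF that] Arg_eq_pi[of z]
    by (auto simp: complex_nonpos_Reals_iff order.strict_iff_order)
  have inv1: "cis (Arg z) = z" if "norm z = 1" for z
    using that by (metis cis_Arg norm_zero zero_neq_one sgn_div_norm inverse_1 scaleR_one)
  have inv2: "Arg (cis t) = t" if "-pi < t" "t < pi" for t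
    using that by (simp add: Arg_cis)
  have ne: "cis t \<noteq> -1" if "-pi < t" "t < pi" for t
    using inv2[OF that] that Arg_cis[of pi] by (auto simp del: Arg_cis)
  show ?thesis
  proof (rule homeomorphismI)
    show "continuous_on (sphere 0 1 - {-1}) (\<lambda>z. vec (Arg z) :: real^1)"
      unfolding vec_def using * by (intro continuous_intros) auto
    show "continuous_on {v :: real^1. -pi < v $ 1 \<and> v $ 1 < pi} (\<lambda>v. cis (v $ 1))"
      by (intro continuous_intros)
  qed (use bd inv1 inv2 ne in \<open>auto simp: vec_nth_1\<close>)
qed

lemma homeomorphism_Arg2pi:
  "homeomorphism (sphere 0 1 - {1}) {v. 0 < v $ 1 \<and> v $ 1 < 2 * pi}
     (\<lambda>z. vec (Arg2pi z) :: real^1) (\<lambda>v. cis (v $ 1))"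
proof -
  have *: "z \<notin> \<real>\<^sub>\<ge>\<^sub>0" if "norm z = 1" "z \<noteq> 1" for z :: complex
    using that by (auto elim!: nonneg_Reals_cases)
  have bd: "0 < Arg2pi z \<and> Arg2pi z < 2 * pi" if "norm z = 1" "z \<noteq> 1" for z :: complex
    using Arg2pi_ge_0[of z] Arg2pi_lt_2pi[of z] *[OF that] Arg2pi_eq_0[of z]
    by (auto simp: complex_nonneg_Reals_iff complex_is_Real_iff order.strict_iff_order)
  have inv1: "cis (Arg2pi z) = z" if "norm z = 1" for z
    using that by (simp add: cis_conv_exp complex_norm_eq_1_exp)
  have inv2: "Arg2pi (cis t) = t" if "0 < t" "t < 2 * pi" for t
    using that by (intro Arg2pi_unique[of 1]) (auto simp: cis_conv_exp)
  have ne: "cis t \<noteq> 1" if "0 < t" "t < 2 * pi" for t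
    using inv2[OF that] that by (metis Arg2pi_of_real of_real_1 less_irrefl not_one_less_zero)
  show ?thesis
  proof (rule homeomorphismI)
    show "continuous_on (sphere 0 1 - {1}) (\<lambda>z. vec (Arg2pi z) :: real^1)"
      unfolding vec_def using * continuous_at_Arg2pi
      by (intro continuous_intros continuous_at_imp_continuous_on) auto
    show "continuous_on {v :: real^1. 0 < v $ 1 \<and> v $ 1 < 2 * pi} (\<lambda>v. cis (v $ 1))"
      by (intro continuous_intros)
  qed (use bd inv1 inv2 ne in \<open>auto simp: vec_nth_1\<close>)
qed

lemma inv_into_homeomorphism:
  assumes "homeomorphism S T f g" "y \<in> T"
  shows "inv_into S f y = g y"
  using assms unfolding homeomorphism_def
  by (metis (no_types, lifting) image_eqI inj_on_inverseI inv_into_f_f)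

lemma open_image_homeomorphism:
  assumes "homeomorphism S T f g" "open T" "openin (top_of_set S) U"
  shows "open (f ` U)"
  using homeomorphism_imp_open_map[OF assms(1,3)] assms(2) openin_open_trans by blast

lemma closed_manifold_circle: "closed_manifold circle"
proof -
  let ?S = "sphere 0 1 :: complex set"
  let ?A = "\<lambda>z. vec (Arg z) :: real^1" and ?B = "\<lambda>z. vec (Arg2pi z) :: real^1"
  let ?U = "?S - {-1}" and ?V = "?S - {1}"
  let ?I = "{v :: real^1. -pi < v $ 1 \<and> v $ 1 < pi}"
  let ?J = "{v :: real^1. 0 < v $ 1 \<and> v $ 1 < 2 * pi}"
  note hA = homeomorphism_Arg and hB = homeomorphism_Arg2pi
  have opn: "open {v :: real^1. a < v $ 1 \<and> v $ 1 < b}" for a b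
    by (intro open_Collect_conj open_Collect_less continuous_intros)
  have iA: "?A ` ?U = ?I" and iB: "?B ` ?V = ?J"
    using hA hB by (simp_all add: homeomorphism_def)
  have opU: "openin (top_of_set ?U) (?U \<inter> W)" "openin (top_of_set ?V) (?V \<inter> W)"
    if "W = ?U \<or> W = ?V" for W
  proof -
    have "W = ?S \<inter> (- {-1}) \<or> W = ?S \<inter> (- {1})" using that by auto
    then have "?U \<inter> W = ?U \<inter> (- {-1}) \<or> ?U \<inter> W = ?U \<inter> (- {1})"
      "?V \<inter> W = ?V \<inter> (- {-1}) \<or> ?V \<inter> W = ?V \<inter> (- {1})" by auto
    then show "openin (top_of_set ?U) (?U \<inter> W)" "openin (top_of_set ?V) (?V \<inter> W)"
      by (metis openin_open_Int open_Compl closed_singleton)+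
  qed
  have opA: "open (?A ` (?U \<inter> W))" and opB: "open (?B ` (?V \<inter> W))" if "W = ?U \<or> W = ?V" for W
    using open_image_homeomorphism[OF hA opn] open_image_homeomorphism[OF hB opn] opU[OF that]
    by blast+
  have invA: "inv_into ?U ?A v = cis (v $ 1)" if "v \<in> ?I" for v
    by (rule inv_into_homeomorphism[OF hA that])
  have invB: "inv_into ?V ?B v = cis (v $ 1)" if "v \<in> ?J" for v
    by (rule inv_into_homeomorphism[OF hB that])
  have memA: "v \<in> ?I" "cis (v $ 1) \<in> W" if "v \<in> ?A ` (?U \<inter> W)" for v W
    using that hA by (auto simp: homeomorphism_def)
  have memB: "v \<in> ?J" "cis (v $ 1) \<in> W" if "v \<in> ?B ` (?V \<inter> W)" for v W
    using that hB by (auto simp: homeomorphism_def)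
  have A1: "vec (Arg (cis (v $ 1))) = v" if "v \<in> ?I" for v :: "real^1"
    using that hA unfolding homeomorphism_def by blast
  have B1: "vec (Arg2pi (cis (v $ 1))) = v" if "v \<in> ?J" for v :: "real^1"
    using that hB unfolding homeomorphism_def by blast
  have per: "cis (t + 2 * pi) = cis t" "cis (t - 2 * pi) = cis t" for t
    by (simp_all add: complex_eq_iff cos_diff sin_diff)
  have A2: "vec (Arg (cis (v $ 1))) = v + vec (- 2 * pi)" if "pi < v $ 1" "v $ 1 < 2 * pi" for v :: "real^1"
    using A1[of "v + vec (- 2 * pi)"] that per(2)[of "v $ 1"] by simp
  have B2: "vec (Arg2pi (cis (v $ 1))) = v + vec (2 * pi)" if "- pi < v $ 1" "v $ 1 < 0" for v :: "real^1"
    using B1[of "v + vec (2 * pi)"] that per(1)[of "v $ 1"] by simp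
  have AA: "smooth_on (?A ` (?U \<inter> ?U)) (?A \<circ> inv_into ?U ?A)"
  proof (rule smooth_on_locally_translation)
    show "open (?A ` (?U \<inter> ?U))" by (rule opA) simp
    show "\<exists>T c. open T \<and> v \<in> T \<and> (\<forall>w\<in>T. (?A \<circ> inv_into ?U ?A) w = w + c)"
      if "v \<in> ?A ` (?U \<inter> ?U)" for v
      by (rule exI[of _ ?I], rule exI[of _ 0]) (use opn memA[OF that] invA A1 in auto)
  qed
  have BB: "smooth_on (?B ` (?V \<inter> ?V)) (?B \<circ> inv_into ?V ?B)"
  proof (rule smooth_on_locally_translation)
    show "open (?B ` (?V \<inter> ?V))" by (rule opB) simp
    show "\<exists>T c. open T \<and> v \<in> T \<and> (\<forall>w\<in>T. (?B \<circ> inv_into ?V ?B) w = w + c)"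
      if "v \<in> ?B ` (?V \<inter> ?V)" for v
      by (rule exI[of _ ?J], rule exI[of _ 0]) (use opn memB[OF that] invB B1 in auto)
  qed
  have AB: "smooth_on (?A ` (?U \<inter> ?V)) (?B \<circ> inv_into ?U ?A)"
  proof (rule smooth_on_locally_translation)
    show "open (?A ` (?U \<inter> ?V))" by (rule opA) simp
    show "\<exists>T c. open T \<and> v \<in> T \<and> (\<forall>w\<in>T. (?B \<circ> inv_into ?U ?A) w = w + c)"
      if v: "v \<in> ?A ` (?U \<inter> ?V)" for v
    proof -
      have "v $ 1 \<noteq> 0" using memA(2)[OF v] by auto
      then consider "v $ 1 < 0" | "v $ 1 > 0" by linarith
      then show ?thesis
      proof cases
        case 1
        show ?thesis
          by (rule exI[of _ "{v. - pi < v $ 1 \<and> v $ 1 < 0}"], rule exI[of _ "vec (2 * pi)"])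
            (use 1 opn memA(1)[OF v] invA B2 in auto)
      next
        case 2
        show ?thesis
          by (rule exI[of _ "{v. 0 < v $ 1 \<and> v $ 1 < pi}"], rule exI[of _ 0])
            (use 2 opn memA(1)[OF v] invA B1 in auto)
      qed
    qed
  qed
  have BA: "smooth_on (?B ` (?V \<inter> ?U)) (?A \<circ> inv_into ?V ?B)"
  proof (rule smooth_on_locally_translation)
    show "open (?B ` (?V \<inter> ?U))" by (rule opB) simp
    show "\<exists>T c. open T \<and> v \<in> T \<and> (\<forall>w\<in>T. (?A \<circ> inv_into ?V ?B) w = w + c)"
      if v: "v \<in> ?B ` (?V \<inter> ?U)" for v
    proof -
      have "v $ 1 \<noteq> pi" using memB(2)[OF v] by auto
      then consider "v $ 1 < pi" | "v $ 1 > pi" by linarith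
      then show ?thesis
      proof cases
        case 1
        show ?thesis
          by (rule exI[of _ "{v. 0 < v $ 1 \<and> v $ 1 < pi}"], rule exI[of _ 0])
            (use 1 opn memB(1)[OF v] invB A1 in auto)
      next
        case 2
        show ?thesis
          by (rule exI[of _ "{v. pi < v $ 1 \<and> v $ 1 < 2 * pi}"], rule exI[of _ "vec (- 2 * pi)"])
            (use 2 opn memB(1)[OF v] invB A2 in auto)
      qed
    qed
  qed
  have cov: "?U \<union> ?V = ?S" by auto
  have opS: "openin (top_of_set ?S) ?U" "openin (top_of_set ?S) ?V"
    by (auto simp: Diff_eq intro!: openin_open_Int open_Compl)
  have sub: "subtopology (top_of_set ?S) ?U = top_of_set ?U"
    "subtopology (top_of_set ?S) ?V = top_of_set ?V"
    by (simp_all add: subtopology_subtopology Int_absorb1)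
  have "smooth_manifold circle"
    unfolding smooth_manifold_def circle_def
    using AA AB BA BB cov opS opn homeomorphism_imp_homeomorphic_map[OF hA]
      homeomorphism_imp_homeomorphic_map[OF hB] second_countable_top_of_set[of ?S]
    by (simp add: sub iA iB Hausdorff_space_subtopology)
  then show ?thesis
    by (simp add: closed_manifold_def circle_def compact_space_subtopology compactin_euclidean_iff)
qed

end

theory Submission
  imports Defs
begin

text \<open>
  On a one-dimensional manifold \<open>N\<close>, fix a point and a chart around it, with coordinate \<open>t\<close>. Since
  a single coordinate vector \<open>\<partial>/\<partial>t\<close> spans the tangent line there, the mixed Hessian of \<open>h\<close> at
  \<open>(x, y)\<close> is just the differential at \<open>x\<close> of the map \<open>F = \<partial>h/\<partial>t (\<cdot>, y)\<close>, and \<open>F\<close> is defined on all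
  of \<open>M\<close>, without reference to coordinates on \<open>M\<close>. So a cross-free \<open>h\<close> would yield a map \<open>F\<close> from
  the compact manifold \<open>M\<close> to a Euclidean space whose differential is surjective everywhere. This is
  impossible: a component of \<open>F\<close> is continuous on \<open>M\<close>, hence attains its maximum; the point lies in
  the interior of a chart because \<open>M\<close> has no boundary, so the differential of that component
  vanishes there, and the image of the differential of \<open>F\<close> lies in a hyperplane.

  The argument is \<open>no_cross_free_map\<close>, for an arbitrary nonempty one-dimensional \<open>N\<close>. It rests on
  \<open>differentiable_partial_derivative\<close>, which makes \<open>F\<close> differentiable in charts of \<open>M\<close>, and on
  \<open>continuous_map_if_continuous_in_charts\<close>, which turns this into continuity on \<open>M\<close>.
\<close>

text \<open>
  A partial derivative of \<open>g\<close> is the total derivative applied to the vector \<open>(0, e)\<close>, and the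
  derivatives of a \<open>C\<^sup>2\<close> map in a constant direction are differentiable.
\<close>

lemma differentiable_partial_derivative:
  fixes g :: "'e::euclidean_space \<times> 'f::euclidean_space \<Rightarrow> 'g::real_normed_vector"
  assumes "open S" "Ck_on 2 S g" "(u, v) \<in> S"
  shows "(\<lambda>u'. frechet_derivative (\<lambda>v'. g (u', v')) (at v) e) differentiable (at u)"
proof -
  have g1: "g differentiable (at p)" if "p \<in> S" for p
    using assms(2) that by (simp add: numeral_2_eq_2)
  have g2: "(\<lambda>p. frechet_derivative g (at p) (0, e)) differentiable (at p)" if "p \<in> S" for p
    using assms(2) that by (simp add: numeral_2_eq_2)
  define T where "T = (\<lambda>u'. (u', v)) -` S"
  have T: "open T" "u \<in> T"
    using assms by (auto simp: T_def intro!: continuous_open_vimage continuous_intros)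
  have partial: "frechet_derivative (\<lambda>v'. g (u', v')) (at v) e = frechet_derivative g (at (u', v)) (0, e)"
    if "u' \<in> T" for u'
  proof -
    have "(g has_derivative frechet_derivative g (at (u', v))) (at (u', v))"
      using g1 that unfolding T_def frechet_derivative_works by blast
    then have "((g \<circ> Pair u') has_derivative (frechet_derivative g (at (u', v)) \<circ> Pair 0)) (at v)"
      by (intro diff_chain_at) (auto intro!: derivative_eq_intros)
    from frechet_derivative_at[OF this] show ?thesis by (simp add: o_def fun_eq_iff)
  qed
  have "((\<lambda>p. frechet_derivative g (at p) (0, e)) \<circ> (\<lambda>u'. (u', v))) differentiable (at u)"
    by (intro differentiable_chain_at g2 assms(3))
       (auto simp: differentiable_def intro!: exI derivative_eq_intros)
  then obtain D where
    "((\<lambda>u'. frechet_derivative g (at (u', v)) (0, e)) has_derivative D) (at u)"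
    by (auto simp: differentiable_def o_def)
  then have "((\<lambda>u'. frechet_derivative (\<lambda>v'. g (u', v')) (at v) e) has_derivative D) (at u)"
    by (rule has_derivative_transform_within_open[OF _ T]) (simp add: partial)
  then show ?thesis by (rule differentiableI)
qed

lemma chartD:
  fixes M :: "('p, 'e::euclidean_space) manifold"
  assumes "smooth_manifold M" "(U, \<phi>) \<in> atlas M"
  shows "open (\<phi> ` U)" and "inj_on \<phi> U" and "openin (mtop M) U"
    and "homeomorphic_map (subtopology (mtop M) U) (top_of_set (\<phi> ` U)) \<phi>"
proof -
  show U: "openin (mtop M) U" "open (\<phi> ` U)"
    and hom: "homeomorphic_map (subtopology (mtop M) U) (top_of_set (\<phi> ` U)) \<phi>"
    using assms by (auto simp: smooth_manifold_def)
  show "inj_on \<phi> U"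
    using homeomorphic_imp_injective_map[OF hom] openin_subset[OF U(1)] by (simp add: Int_absorb1)
qed

lemma chart_exists:
  fixes M :: "('p, 'e::euclidean_space) manifold"
  assumes "smooth_manifold M" "x \<in> topspace (mtop M)"
  obtains U \<phi> where "(U, \<phi>) \<in> atlas M" "x \<in> U"
proof -
  have "x \<in> \<Union> (fst ` atlas M)" using assms by (simp add: smooth_manifold_def)
  then show ?thesis using that by auto
qed

text \<open>
  Continuity is local and charts are homeomorphisms onto their images, so the restrictions of \<open>F\<close>
  to the chart domains are continuous and can be pasted together.
\<close>

lemma continuous_map_if_continuous_in_charts:
  fixes M :: "('p, 'e::euclidean_space) manifold" and F :: "'p \<Rightarrow> 'f::real_normed_vector"
  assumes "smooth_manifold M"
    and "\<And>U \<phi>. (U, \<phi>) \<in> atlas M \<Longrightarrow> continuous_on (\<phi> ` U) (F \<circ> inv_into U \<phi>)"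
  shows "continuous_map (mtop M) euclidean F"
proof (rule pasting_lemma[where I = "atlas M" and T = fst and f = "\<lambda>_. F"])
  fix c assume c: "c \<in> atlas M"
  obtain U \<phi> where [simp]: "c = (U, \<phi>)" by (cases c)
  note chart = chartD[OF assms(1), of U \<phi>]
  show "openin (mtop M) (fst c)" using chart(3) c by simp
  have "continuous_map (top_of_set (\<phi> ` U)) euclidean (F \<circ> inv_into U \<phi>)"
    using assms(2) c by (simp del: o_apply)
  then have "continuous_map (subtopology (mtop M) U) euclidean ((F \<circ> inv_into U \<phi>) \<circ> \<phi>)"
    using c by (intro continuous_map_compose[OF homeomorphic_imp_continuous_map[OF chart(4)]]) auto
  then have "continuous_map (subtopology (mtop M) U) euclidean F"
    by (rule continuous_map_eq) (use chart(2) c in auto)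
  then show "continuous_map (subtopology (mtop M) (fst c)) euclidean F"
    by simp
next
  show "\<exists>c. c \<in> atlas M \<and> p \<in> fst c \<and> F p = F p" if p: "p \<in> topspace (mtop M)" for p
  proof -
    obtain U \<phi> where "(U, \<phi>) \<in> atlas M" "p \<in> U"
      using chart_exists[OF assms(1) p] .
    then show ?thesis by (intro exI[of _ "(U, \<phi>)"]) simp
  qed
qed auto

lemma inv_into_map_prod:
  assumes "inj_on \<phi> U" "inj_on \<psi> V" "u \<in> \<phi> ` U" "v \<in> \<psi> ` V"
  shows "inv_into (U \<times> V) (map_prod \<phi> \<psi>) (u, v) = (inv_into U \<phi> u, inv_into V \<psi> v)"
proof -
  have "inv_into (U \<times> V) (map_prod \<phi> \<psi>)
      (map_prod \<phi> \<psi> (inv_into U \<phi> u, inv_into V \<psi> v)) = (inv_into U \<phi> u, inv_into V \<psi> v)"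
    using assms by (intro inv_into_f_f map_prod_inj_on) (auto intro: inv_into_into)
  then show ?thesis
    using assms by (simp add: f_inv_into_f)
qed

text \<open>
  The equivalence, rather than one implication, gives equality of \<^const>\<open>frechet_derivative\<close>
  directly, as this is a choice among all derivatives.
\<close>

lemma has_derivative_cong_local:
  assumes "open S" "x \<in> S" "\<And>y. y \<in> S \<Longrightarrow> f y = g y"
  shows "(f has_derivative D) (at x) \<longleftrightarrow> (g has_derivative D) (at x)"
proof
  show "(g has_derivative D) (at x)" if "(f has_derivative D) (at x)"
    using that assms(3) by (rule has_derivative_transform_within_open[OF _ assms(1,2)])
  show "(f has_derivative D) (at x)" if "(g has_derivative D) (at x)"
    using that assms(3)[symmetric] by (rule has_derivative_transform_within_open[OF _ assms(1,2)])
qed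

text \<open>
  The maximum principle: \<open>F\<close> below is the derivative of \<open>h\<close> in the coordinate direction of \<open>N\<close>,
  and at a maximum of one of its components the mixed Hessian misses the corresponding basis vector.
\<close>

lemma no_cross_free_map:
  fixes M :: "('p, real ^ 'm) manifold" and N :: "('q, real ^ 1) manifold"
    and h :: "'p \<times> 'q \<Rightarrow> real ^ 'k"
  assumes "closed_manifold M" "topspace (mtop M) \<noteq> {}"
    and "smooth_manifold N" "topspace (mtop N) \<noteq> {}"
  shows "\<not> cross_free M N h"
proof
  assume cf: "cross_free M N h"
  have M: "smooth_manifold M" and compact: "compact_space (mtop M)"
    using assms(1) by (auto simp: closed_manifold_def)
  obtain y where "y \<in> topspace (mtop N)" using assms(4) by blast
  then obtain V \<psi> where V: "(V, \<psi>) \<in> atlas N" "y \<in> V"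
    using chart_exists[OF assms(3)] by blast
  define v where "v = \<psi> y"
  note N_chart = chartD[OF assms(3) V(1)]
  have v: "v \<in> \<psi> ` V" using V by (simp add: v_def)
  \<comment> \<open>Any component of \<open>F\<close> serves for the maximum.\<close>
  define k :: 'k where "k = undefined"
  define e :: "real ^ 1" where "e = axis 1 1"
  define F where "F x = frechet_derivative (\<lambda>v'. h (x, inv_into V \<psi> v')) (at v) e" for x
  define g where "g U \<phi> = h \<circ> inv_into (U \<times> V) (map_prod \<phi> \<psi>)" for U and \<phi> :: "'p \<Rightarrow> real ^ 'm"
  define G where "G U \<phi> u = frechet_derivative (\<lambda>v'. g U \<phi> (u, v')) (at v) e"
    for U and \<phi> :: "'p \<Rightarrow> real ^ 'm" and u

  \<comment> \<open>\<open>G U \<phi>\<close>, the expression inside the mixed partials, is \<open>F\<close> read in the chart \<open>(U, \<phi>)\<close>; it is \<open>F\<close>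
     that makes values from different charts comparable.\<close>
  have G_diff: "G U \<phi> differentiable (at u)" and G_F: "G U \<phi> u = F (inv_into U \<phi> u)"
    if U: "(U, \<phi>) \<in> atlas M" and u: "u \<in> \<phi> ` U" for U \<phi> u
  proof -
    note M_chart = chartD[OF M U]
    have "(U \<times> V, map_prod \<phi> \<psi>) \<in> atlas (prod_manifold M N)"
      using U V by (auto simp: prod_manifold_def)
    moreover have "map_prod \<phi> \<psi> ` (U \<times> V) = \<phi> ` U \<times> \<psi> ` V" by auto
    moreover have "\<forall>(W, \<theta>) \<in> atlas (prod_manifold M N). smooth_on (\<theta> ` W) (h \<circ> inv_into W \<theta>)"
      using cf unfolding cross_free_def smooth_map_def by (rule conjunct1)
    ultimately have "smooth_on (\<phi> ` U \<times> \<psi> ` V) (g U \<phi>)"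
      unfolding g_def by (metis (no_types, lifting) case_prodD)
    then have C2: "Ck_on 2 (\<phi> ` U \<times> \<psi> ` V) (g U \<phi>)"
      by (simp add: smooth_on_def)
    have "open (\<phi> ` U \<times> \<psi> ` V)" using M_chart N_chart by (intro open_Times)
    then show "G U \<phi> differentiable (at u)"
      unfolding G_def using differentiable_partial_derivative[OF _ C2] u v by blast
    have "g U \<phi> (u, v') = h (inv_into U \<phi> u, inv_into V \<psi> v')" if "v' \<in> \<psi> ` V" for v'
      using inv_into_map_prod[OF M_chart(2) N_chart(2) u that] by (simp add: g_def)
    then have "((\<lambda>v'. g U \<phi> (u, v')) has_derivative D) (at v) \<longleftrightarrow>
        ((\<lambda>v'. h (inv_into U \<phi> u, inv_into V \<psi> v')) has_derivative D) (at v)" for D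
      by (rule has_derivative_cong_local[OF N_chart(1) v])
    then show "G U \<phi> u = F (inv_into U \<phi> u)"
      by (simp add: G_def F_def frechet_derivative_def)
  qed

  have "continuous_map (mtop M) euclidean F"
  proof (rule continuous_map_if_continuous_in_charts[OF M])
    fix U \<phi> assume U: "(U, \<phi>) \<in> atlas M"
    have "continuous_on (\<phi> ` U) (G U \<phi>)"
      using G_diff[OF U]
      by (auto intro!: continuous_at_imp_continuous_on differentiable_imp_continuous_within)
    then show "continuous_on (\<phi> ` U) (F \<circ> inv_into U \<phi>)"
      by (rule continuous_on_eq) (simp add: G_F[OF U])
  qed
  then have "compactin euclidean (F ` topspace (mtop M))"
    using compact image_compactin unfolding compact_space_def by blast
  then have "compact ((\<lambda>z. z $ k) ` F ` topspace (mtop M))"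
    by (intro compact_continuous_image continuous_intros) (simp add: compactin_euclidean_iff)
  then obtain x where x: "x \<in> topspace (mtop M)"
    and max: "\<And>x'. x' \<in> topspace (mtop M) \<Longrightarrow> F x' $ k \<le> F x $ k"
    using compact_attains_sup[of "(\<lambda>z. z $ k) ` F ` topspace (mtop M)"] assms(2) by auto
  obtain U \<phi> where U: "(U, \<phi>) \<in> atlas M" "x \<in> U"
    using chart_exists[OF M x] by blast
  note M_chart = chartD[OF M U(1)]
  have u: "\<phi> x \<in> \<phi> ` U" using U by blast
  define D where "D = frechet_derivative (G U \<phi>) (at (\<phi> x))"
  have "(G U \<phi> has_derivative D) (at (\<phi> x))"
    unfolding D_def using G_diff[OF U(1) u] frechet_derivative_works by blast
  then have "((\<lambda>u. G U \<phi> u $ k) has_derivative (\<lambda>w. D w $ k)) (at (\<phi> x))"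
    by (rule bounded_linear.has_derivative[OF bounded_linear_vec_nth])
  moreover have "G U \<phi> u' $ k \<le> G U \<phi> (\<phi> x) $ k" if "u' \<in> \<phi> ` U" for u'
  proof -
    have "inv_into U \<phi> u' \<in> topspace (mtop M)"
      using inv_into_into[OF that] openin_subset[OF M_chart(3)] by blast
    then show ?thesis
      using max U M_chart by (simp add: G_F[OF U(1)] that)
  qed
  ultimately have "(\<lambda>w. D w $ k) = (\<lambda>w. 0)"
    using differential_zero_maxmin[OF u M_chart(1)] by blast
  then have D0: "D w $ k = 0" for w by (rule fun_cong)

  have "mixed_hessian (g U \<phi>) (\<phi> x) v t $ k = 0" for t
    using D0 by (simp add: mixed_hessian_def mixed_partial_def D_def G_def[abs_def] e_def)
  moreover have "\<forall>(U, \<phi>) \<in> atlas M. \<forall>(V, \<psi>) \<in> atlas N. \<forall>x\<in>U. \<forall>y\<in>V.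
      bij (mixed_hessian (h \<circ> inv_into (U \<times> V) (map_prod \<phi> \<psi>)) (\<phi> x) (\<psi> y))"
    using cf unfolding cross_free_def by (rule conjunct2)
  from bspec[OF this U(1), THEN case_prodD, THEN bspec, OF V(1), THEN case_prodD, THEN bspec,
      OF U(2), THEN bspec, OF V(2)]
  have "surj (mixed_hessian (g U \<phi>) (\<phi> x) v)"
    unfolding g_def v_def by (rule bij_is_surj)
  from surjD[OF this] obtain t where "axis k 1 = mixed_hessian (g U \<phi>) (\<phi> x) v t" ..
  from this[symmetric] have "mixed_hessian (g U \<phi>) (\<phi> x) v t $ k = 1"
    by simp
  ultimately show False by simp
qed

theorem proposition3:
  fixes M :: "('p, real ^ 'm) manifold"
  assumes "closed_manifold M"
    and "topspace (mtop M) \<noteq> {}"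
  shows "(P_infinity M real_line :: ('p \<times> real \<Rightarrow> real ^ 'm) set) = {} \<and>
         (P_infinity M circle :: ('p \<times> complex \<Rightarrow> real ^ 'm) set) = {}"
proof -
  have line: "topspace (mtop real_line) \<noteq> {}" and circ: "topspace (mtop circle) \<noteq> {}"
    by (simp_all add: real_line_def circle_def)
  have "smooth_manifold circle"
    using closed_manifold_circle by (simp add: closed_manifold_def)
  note none = no_cross_free_map[OF assms smooth_manifold_real_line line]
    no_cross_free_map[OF assms this circ]
  show ?thesis
    by (simp add: P_infinity_def none)
qed

end
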